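(* Let $(x_j,y_j)\in\mathbb{R}_{\ge 0}^m\times\mathbb{R}_{\ge 0}^s$ ($j=1,\dots,n$) be input-output data with $x_j\ne0$, $y_j\neq 0$, let $o\in\{1,\dots,n\}$, $J=\{1,\dots,n\}\setminus\{o\}$, $0\le L\le 1\le U\le\infty$, and let $g=(g^-,-g^+)$ with $g^-\in\mathbb{R}_{\ge 0}^m$, $g^+\in\mathbb{R}_{\ge 0}^s$ be a fixed direction vector. Let $\mathrm{DMU}_p$ be the unit with inputs $a_i x_{io}$ ($i=1,\dots,m$) and outputs $b_r y_{ro}$ ($r=1,\dots,s$), where $0<a_i\le 1$ for all $i$ and $b_r\ge 1$ for all $r$. Then the optimal value of the Fractional GDSE model for $\mathrm{DMU}_p$ is not less than that for $\mathrm{DMU}_o$: $$\rho_o^F(g)\le\rho_p^F(g),$$ where both values are computed with the same reference data $(x_j,y_j)_{j\in J}$ and the same direction vector $g$.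
   Context: $\mathrm{DMU}_j$ denotes the decision making unit with inputs $x_j=(x_{1j},\dots,x_{mj})$ and outputs $y_j=(y_{1j},\dots,y_{sj})$; $J$ is the reference set, which excludes $\mathrm{DMU}_o$. For a unit $k\in\{o,p\}$ with inputs $x_{ik}$ and outputs $y_{rk}$, the Fractional GDSE value $\rho_k^F(g)$ is the minimum (infimum) of $$\frac{1+\frac1m\sum_{i=1}^m\tau_i^-}{1-\frac1s\sum_{r=1}^s\tau_r^+}$$ over all $(\lambda_j)_{j\in J},(\tau_i^-)_{i=1}^m,(\tau_r^+)_{r=1}^s$ satisfying $$\sum_{j\in J}\lambda_j x_{ij}\le x_{ik}+\tau_i^- g_i^-\ (i=1,\dots,m),\qquad \sum_{j\in J}\lambda_j y_{rj}\ge y_{rk}-\tau_r^+ g_r^+\ (r=1,\dots,s),$$ $$L\le\sum_{j\in J}\lambda_j\le U,\qquad \lambda_j,\tau_i^-,\tau_r^+\ge 0\ \text{ for all } j,i,r,$$ and for which the denominator is positive, i.e. $\frac1s\sum_{r}\tau_r^+<1$ (the value is $+\infty$ if there are no such points). *)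

theory Defs
  imports "HOL-Analysis.Analysis"
begin

text \<open>
  The reference set \<open>J\<close> is a finite set of indices, with data \<open>x j\<close> (inputs) and \<open>y j\<close> (outputs).
  The unit under evaluation is given by its own data \<open>xk\<close>, \<open>yk\<close>, since it need not be one of
  the reference units.  The direction vector is \<open>(gm, - gp)\<close>.  The upper bound \<open>U\<close> on the
  intensity sum is an extended real, so that it may be infinite.
\<close>

definition fgdse_feasible ::
  "'j set \<Rightarrow> ('j \<Rightarrow> real ^ 'm) \<Rightarrow> ('j \<Rightarrow> real ^ 's) \<Rightarrow> real \<Rightarrow> ereal
    \<Rightarrow> real ^ 'm \<Rightarrow> real ^ 's \<Rightarrow> real ^ 'm \<Rightarrow> real ^ 's
    \<Rightarrow> (('j \<Rightarrow> real) \<times> (real ^ 'm) \<times> (real ^ 's)) set"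
  where
  "fgdse_feasible J x y L U gm gp xk yk =
    {(l, tm, tp).
       (\<forall>i. (\<Sum>j\<in>J. l j * x j $ i) \<le> xk $ i + tm $ i * gm $ i) \<and>
       (\<forall>r. (\<Sum>j\<in>J. l j * y j $ r) \<ge> yk $ r - tp $ r * gp $ r) \<and>
       L \<le> (\<Sum>j\<in>J. l j) \<and> ereal (\<Sum>j\<in>J. l j) \<le> U \<and>
       (\<forall>j\<in>J. 0 \<le> l j) \<and> (\<forall>i. 0 \<le> tm $ i) \<and> (\<forall>r. 0 \<le> tp $ r) \<and>
       (1 / real CARD('s)) * (\<Sum>r\<in>UNIV. tp $ r) < 1}"

definition fgdse_objective :: "real ^ 'm \<Rightarrow> real ^ 's \<Rightarrow> real"
  where
  "fgdse_objective tm tp =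
    (1 + (1 / real CARD('m)) * (\<Sum>i\<in>UNIV. tm $ i)) /
    (1 - (1 / real CARD('s)) * (\<Sum>r\<in>UNIV. tp $ r))"

text \<open>The infimum over the empty set is \<open>\<infinity>\<close> in the extended reals.\<close>

definition fgdse_value ::
  "'j set \<Rightarrow> ('j \<Rightarrow> real ^ 'm) \<Rightarrow> ('j \<Rightarrow> real ^ 's) \<Rightarrow> real \<Rightarrow> ereal
    \<Rightarrow> real ^ 'm \<Rightarrow> real ^ 's \<Rightarrow> real ^ 'm \<Rightarrow> real ^ 's \<Rightarrow> ereal"
  where
  "fgdse_value J x y L U gm gp xk yk =
    (INF (l, tm, tp) \<in> fgdse_feasible J x y L U gm gp xk yk. ereal (fgdse_objective tm tp))"

end

theory Submission
  imports Defs
begin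

text \<open>The data of the evaluated unit enter only the right-hand sides of the input and output
  constraints, while the objective depends on the slacks alone. Smaller inputs and larger outputs
  tighten these constraints, so the feasible set shrinks (\<open>fgdse_feasible_mono\<close>) and
  its infimum cannot decrease (\<open>fgdse_value_mono\<close>). Scaling by \<open>a\<close> and
  \<open>b\<close> changes nonnegative data in exactly these directions.\<close>

lemma fgdse_feasible_mono:
  assumes "\<And>i. xp $ i \<le> xk $ i" and "\<And>r. yk $ r \<le> yp $ r"
  shows "fgdse_feasible J x y L U gm gp xp yp \<subseteq> fgdse_feasible J x y L U gm gp xk yk"
proof clarify
  fix l tm tp
  assume feas: "(l, tm, tp) \<in> fgdse_feasible J x y L U gm gp xp yp"
  have "(\<Sum>j\<in>J. l j * x j $ i) \<le> xk $ i + tm $ i * gm $ i" for i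
  proof -
    have "(\<Sum>j\<in>J. l j * x j $ i) \<le> xp $ i + tm $ i * gm $ i"
      using feas by (simp add: fgdse_feasible_def)
    with assms(1)[of i] show ?thesis by linarith
  qed
  moreover have "yk $ r - tp $ r * gp $ r \<le> (\<Sum>j\<in>J. l j * y j $ r)" for r
  proof -
    have "yp $ r - tp $ r * gp $ r \<le> (\<Sum>j\<in>J. l j * y j $ r)"
      using feas by (simp add: fgdse_feasible_def)
    with assms(2)[of r] show ?thesis by linarith
  qed
  \<comment> \<open>The remaining constraints (intensity sum, signs, positive denominator) do not
    mention the unit's data and carry over verbatim.\<close>
  ultimately show "(l, tm, tp) \<in> fgdse_feasible J x y L U gm gp xk yk"
    using feas by (simp add: fgdse_feasible_def)
qed

text \<open>Both values are infima of the same function over nested sets. An empty smaller set is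
  covered too, since its infimum is \<infinity>.\<close>

lemma fgdse_value_mono:
  assumes "\<And>i. xp $ i \<le> xk $ i" and "\<And>r. yk $ r \<le> yp $ r"
  shows "fgdse_value J x y L U gm gp xk yk \<le> fgdse_value J x y L U gm gp xp yp"
  unfolding fgdse_value_def
  by (rule INF_superset_mono[OF fgdse_feasible_mono]) (use assms in auto)

theorem theorem4p3p2:
  fixes n d :: nat
    and x :: "nat \<Rightarrow> real ^ 'm" and y :: "nat \<Rightarrow> real ^ 's"
    and L :: real and U :: ereal
    and gm :: "real ^ 'm" and gp :: "real ^ 's"
    and a :: "real ^ 'm" and b :: "real ^ 's"
  assumes "\<And>j i. j \<in> {1..n} \<Longrightarrow> 0 \<le> x j $ i"
    and "\<And>j r. j \<in> {1..n} \<Longrightarrow> 0 \<le> y j $ r"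
    and "\<And>j. j \<in> {1..n} \<Longrightarrow> x j \<noteq> 0"
    and "\<And>j. j \<in> {1..n} \<Longrightarrow> y j \<noteq> 0"
    and "d \<in> {1..n}"
    and "0 \<le> L" and "L \<le> 1" and "1 \<le> U"
    and "\<And>i. 0 \<le> gm $ i" and "\<And>r. 0 \<le> gp $ r"
    and "\<And>i. 0 < a $ i" and "\<And>i. a $ i \<le> 1"
    and "\<And>r. 1 \<le> b $ r"
  shows "fgdse_value ({1..n} - {d}) x y L U gm gp (x d) (y d)
       \<le> fgdse_value ({1..n} - {d}) x y L U gm gp
            (\<chi> i. a $ i * x d $ i) (\<chi> r. b $ r * y d $ r)"
proof (rule fgdse_value_mono)
  \<comment> \<open>A factor in (0, 1] does not enlarge the input, which is nonnegative because
    \<open>d\<close> lies in \<open>{1..n}\<close>.\<close>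
  show "(\<chi> i. a $ i * x d $ i) $ i \<le> x d $ i" for i
    using assms(1)[OF assms(5), of i] assms(11)[of i] assms(12)[of i]
    by (simp add: mult_left_le_one_le)
  \<comment> \<open>Multiply \<open>1 \<le> b $ r\<close> by the nonnegative output
    \<open>y d $ r\<close>.\<close>
  show "y d $ r \<le> (\<chi> r. b $ r * y d $ r) $ r" for r
    using mult_right_mono[OF assms(13)[of r] assms(2)[OF assms(5), of r]] by simp
qed

end
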